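(* Let $T:V\to\mathfrak g$ be a relative Rota-Baxter operator on an $n$-LieRep pair $(\mathfrak g,[-,\cdots,-]_{\mathfrak g};\rho)$. Then there exists an $n$-pre-Lie algebra structure on $V$ given by $$\{u_1,\cdots,u_n\}_T=\rho(Tu_1,\cdots,Tu_{n-1})(u_n),\qquad\forall\,u_1,\cdots,u_n\in V.$$ Furthermore, $(V,[-,\cdots,-]_T)$ is the sub-adjacent $n$-Lie algebra of the $n$-pre-Lie algebra $(V,\{-,\cdots,-\}_T)$, where the bracket $[-,\cdots,-]_T:\wedge^nV\to V$ is given by $$[u_1,\cdots,u_n]_T=\sum_{i=1}^n(-1)^{n-i}\rho(Tu_1,\cdots,\widehat{Tu_i},\cdots,Tu_n)(u_i),$$ and $T$ is an $n$-Lie algebra morphism from $(V,[-,\cdots,-]_T)$ to $(\mathfrak g,[-,\cdots,-]_{\mathfrak g})$.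
   Context: All vector spaces are finite dimensional over an algebraically closed field of characteristic $0$; $n\ge2$; a hat denotes omission. An $n$-Lie algebra is a vector space $\mathfrak g$ with a skew-symmetric linear map $[-,\cdots,-]_{\mathfrak g}:\wedge^n\mathfrak g\to\mathfrak g$ such that $[x_1,\cdots,x_{n-1},[y_1,\cdots,y_n]]=\sum_{i=1}^n[y_1,\cdots,y_{i-1},[x_1,\cdots,x_{n-1},y_i],y_{i+1},\cdots,y_n]$. A representation of it on $V$ is a linear map $\rho:\wedge^{n-1}\mathfrak g\to\mathfrak{gl}(V)$ with (i) $[\rho(\mathfrak X),\rho(\mathfrak Y)]=\rho(\mathfrak X\circ\mathfrak Y)$ (commutator on the left), where for $\mathfrak X=x_1\wedge\cdots\wedge x_{n-1}$, $\mathfrak Y=y_1\wedge\cdots\wedge y_{n-1}$, $\mathfrak X\circ\mathfrak Y=\sum_{i=1}^{n-1}y_1\wedge\cdots\wedge[x_1,\cdots,x_{n-1},y_i]_{\mathfrak g}\wedge\cdots\wedge y_{n-1}$; and (ii) $\rho(x_1,\cdots,x_{n-2},[y_1,\cdots,y_n]_{\mathfrak g})=\sum_{i=1}^n(-1)^{n-i}\rho(y_1,\cdots,\widehat{y_i},\cdots,y_n)\rho(x_1,\cdots,x_{n-2},y_i)$. An $n$-LieRep pair $(\mathfrak g,[-,\cdots,-]_{\mathfrak g};\rho)$ is an $n$-Lie algebra together with a representation $\rho$ on a vector space $V$. A relative Rota-Baxter operator on it is a linear map $T:V\to\mathfrak g$ with $[Tv_1,\cdots,Tv_n]_{\mathfrak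 g}=\sum_{i=1}^n(-1)^{n-i}T(\rho(Tv_1,\cdots,\widehat{Tv_i},\cdots,Tv_n)(v_i))$ for all $v_i\in V$. An $n$-pre-Lie algebra is a vector space $A$ with a multilinear map $\{-,\cdots,-\}:\wedge^{n-1}A\otimes A\to A$ such that for all $x_i,y_j\in A$: (1) $\{x_1,\cdots,x_{n-1},\{y_1,\cdots,y_{n-1},y_n\}\}=\sum_{i=1}^{n-1}\{y_1,\cdots,y_{i-1},[x_1,\cdots,x_{n-1},y_i]_C,y_{i+1},\cdots,y_n\}+\{y_1,\cdots,y_{n-1},\{x_1,\cdots,x_{n-1},y_n\}\}$; (2) $\{[y_1,\cdots,y_n]_C,x_1,\cdots,x_{n-2},x_{n-1}\}=\sum_{i=1}^n(-1)^{n-i}\{y_1,\cdots,\widehat{y_i},\cdots,y_n,\{y_i,x_1,\cdots,x_{n-2},x_{n-1}\}\}$, where $[x_1,\cdots,x_n]_C=\sum_{i=1}^n(-1)^{n-i}\{x_1,\cdots,\widehat{x_i},\cdots,x_n,x_i\}$. The sub-adjacent $n$-Lie algebra of $(A,\{-,\cdots,-\})$ is $(A,[-,\cdots,-]_C)$. An $n$-Lie algebra morphism is a linear map preserving the $n$-brackets. *)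

theory Defs
  imports "HOL-Computational_Algebra.Polynomial"
begin

text \<open>
  A map of \<open>m\<close> vector arguments is a function on lists, of which only the values on
  lists of length \<open>m\<close> matter.  Indices are 0-based, so the sign
  \<open>(-1)^(n-i)\<close> with \<open>i = 1, ..., n\<close> becomes \<open>(-1)^(n - Suc i)\<close>
  with \<open>i < n\<close>.  A vector space is a whole type together with its scalar multiplication.
\<close>

definition omit :: "nat \<Rightarrow> 'a list \<Rightarrow> 'a list" where
  "omit i xs = take i xs @ drop (Suc i) xs"

definition fin_dim_vector_space :: "('k::field \<Rightarrow> 'a::ab_group_add \<Rightarrow> 'a) \<Rightarrow> bool" where
  "fin_dim_vector_space s \<longleftrightarrow> (\<exists>B. finite_dimensional_vector_space s B)"

text \<open>A linear map out of the \<open>m\<close>-th exterior power is an alternating multilinear map.\<close>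

definition wedge_map ::
  "nat \<Rightarrow> ('k::field \<Rightarrow> 'a::ab_group_add \<Rightarrow> 'a) \<Rightarrow> ('k \<Rightarrow> 'b::ab_group_add \<Rightarrow> 'b) \<Rightarrow> ('a list \<Rightarrow> 'b) \<Rightarrow> bool" where
  "wedge_map m sA sB f \<longleftrightarrow>
     (\<forall>xs i. length xs = m \<and> i < m \<longrightarrow> Vector_Spaces.linear sA sB (\<lambda>x. f (xs[i := x]))) \<and>
     (\<forall>xs i j. length xs = m \<and> i < j \<and> j < m \<and> xs ! i = xs ! j \<longrightarrow> f xs = 0)"

text \<open>
  Linear maps from the \<open>m\<close>-th exterior power of \<open>A\<close> to the endomorphisms of
  \<open>V\<close>, equivalently linear maps from that exterior power tensor \<open>V\<close> to \<open>V\<close>.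
\<close>

definition wedge_End_map ::
  "nat \<Rightarrow> ('k::field \<Rightarrow> 'a::ab_group_add \<Rightarrow> 'a) \<Rightarrow> ('k \<Rightarrow> 'v::ab_group_add \<Rightarrow> 'v) \<Rightarrow>
     ('a list \<Rightarrow> 'v \<Rightarrow> 'v) \<Rightarrow> bool" where
  "wedge_End_map m sA sV f \<longleftrightarrow>
     (\<forall>xs. length xs = m \<longrightarrow> Vector_Spaces.linear sV sV (f xs)) \<and>
     (\<forall>v. wedge_map m sA sV (\<lambda>xs. f xs v))"

locale n_Lie_algebra =
  fixes n :: nat
    and sg :: "'k::field \<Rightarrow> 'g::ab_group_add \<Rightarrow> 'g"
    and br :: "'g list \<Rightarrow> 'g"
  assumes n_ge_2: "2 \<le> n"
    and fin_dim: "fin_dim_vector_space sg"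
    and bracket_wedge: "wedge_map n sg sg br"
    and fundamental_identity:
      "\<And>xs ys. length xs = n - 1 \<Longrightarrow> length ys = n \<Longrightarrow>
         br (xs @ [br ys]) = (\<Sum>i<n. br (ys[i := br (xs @ [ys ! i])]))"

text \<open>
  The first representation identity is an equation between bilinear expressions in two elements
  of the exterior power, so it is stated for decomposable elements.
\<close>

locale n_LieRep_pair = n_Lie_algebra n sg br
  for n :: nat
    and sg :: "'k::field \<Rightarrow> 'g::ab_group_add \<Rightarrow> 'g"
    and br :: "'g list \<Rightarrow> 'g" +
  fixes sV :: "'k \<Rightarrow> 'v::ab_group_add \<Rightarrow> 'v"
    and \<rho> :: "'g list \<Rightarrow> 'v \<Rightarrow> 'v"
  assumes fin_dim_V: "fin_dim_vector_space sV"
    and rho_wedge: "wedge_End_map (n - 1) sg sV \<rho>"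
    and rho_commutator:
      "\<And>xs ys v. length xs = n - 1 \<Longrightarrow> length ys = n - 1 \<Longrightarrow>
         \<rho> xs (\<rho> ys v) - \<rho> ys (\<rho> xs v) = (\<Sum>i<n - 1. \<rho> (ys[i := br (xs @ [ys ! i])]) v)"
    and rho_bracket:
      "\<And>xs ys v. length xs = n - 2 \<Longrightarrow> length ys = n \<Longrightarrow>
         \<rho> (xs @ [br ys]) v =
           (\<Sum>i<n. sV ((-1) ^ (n - Suc i)) (\<rho> (omit i ys) (\<rho> (xs @ [ys ! i]) v)))"

locale relative_Rota_Baxter_operator = n_LieRep_pair n sg br sV \<rho>
  for n :: nat
    and sg :: "'k::field \<Rightarrow> 'g::ab_group_add \<Rightarrow> 'g"
    and br :: "'g list \<Rightarrow> 'g"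
    and sV :: "'k \<Rightarrow> 'v::ab_group_add \<Rightarrow> 'v"
    and \<rho> :: "'g list \<Rightarrow> 'v \<Rightarrow> 'v" +
  fixes T :: "'v \<Rightarrow> 'g"
  assumes linear_T: "Vector_Spaces.linear sV sg T"
    and Rota_Baxter:
      "\<And>vs. length vs = n \<Longrightarrow>
         br (map T vs) =
           (\<Sum>i<n. sg ((-1) ^ (n - Suc i)) (T (\<rho> (map T (omit i vs)) (vs ! i))))"

text \<open>
  An \<open>n\<close>-pre-Lie operation is curried: \<open>P [x1, ..., x(n-1)] y\<close> stands for
  \<open>{x1, ..., x(n-1), y}\<close>.
\<close>

definition subadjacent_bracket ::
  "nat \<Rightarrow> ('k::field \<Rightarrow> 'a::ab_group_add \<Rightarrow> 'a) \<Rightarrow> ('a list \<Rightarrow> 'a \<Rightarrow> 'a) \<Rightarrow> 'a list \<Rightarrow> 'a" where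
  "subadjacent_bracket n sA P xs = (\<Sum>i<n. sA ((-1) ^ (n - Suc i)) (P (omit i xs) (xs ! i)))"

locale n_pre_Lie_algebra =
  fixes n :: nat
    and sA :: "'k::field \<Rightarrow> 'a::ab_group_add \<Rightarrow> 'a"
    and P :: "'a list \<Rightarrow> 'a \<Rightarrow> 'a"
  assumes n_ge_2: "2 \<le> n"
    and fin_dim: "fin_dim_vector_space sA"
    and product_wedge: "wedge_End_map (n - 1) sA sA P"
    and pre_Lie_1:
      "\<And>xs ys z. length xs = n - 1 \<Longrightarrow> length ys = n - 1 \<Longrightarrow>
         P xs (P ys z) =
           (\<Sum>i<n - 1. P (ys[i := subadjacent_bracket n sA P (xs @ [ys ! i])]) z) + P ys (P xs z)"
    and pre_Lie_2:
      "\<And>ys xs z. length ys = n \<Longrightarrow> length xs = n - 2 \<Longrightarrow>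
         P (subadjacent_bracket n sA P ys # xs) z =
           (\<Sum>i<n. sA ((-1) ^ (n - Suc i)) (P (omit i ys) (P (ys ! i # xs) z)))"

definition is_subadjacent_n_Lie_algebra ::
  "nat \<Rightarrow> ('k::field \<Rightarrow> 'a::ab_group_add \<Rightarrow> 'a) \<Rightarrow> ('a list \<Rightarrow> 'a \<Rightarrow> 'a) \<Rightarrow> ('a list \<Rightarrow> 'a) \<Rightarrow> bool" where
  "is_subadjacent_n_Lie_algebra n sA P br \<longleftrightarrow>
     n_pre_Lie_algebra n sA P \<and> n_Lie_algebra n sA br \<and>
     (\<forall>xs. length xs = n \<longrightarrow> br xs = subadjacent_bracket n sA P xs)"

definition n_Lie_morphism ::
  "nat \<Rightarrow> ('k::field \<Rightarrow> 'a::ab_group_add \<Rightarrow> 'a) \<Rightarrow> ('a list \<Rightarrow> 'a) \<Rightarrow>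
     ('k \<Rightarrow> 'b::ab_group_add \<Rightarrow> 'b) \<Rightarrow> ('b list \<Rightarrow> 'b) \<Rightarrow> ('a \<Rightarrow> 'b) \<Rightarrow> bool" where
  "n_Lie_morphism n sA brA sB brB f \<longleftrightarrow>
     n_Lie_algebra n sA brA \<and> n_Lie_algebra n sB brB \<and> Vector_Spaces.linear sA sB f \<and>
     (\<forall>xs. length xs = n \<longrightarrow> f (brA xs) = brB (map f xs))"

definition product_T :: "('g list \<Rightarrow> 'v \<Rightarrow> 'v) \<Rightarrow> ('v \<Rightarrow> 'g) \<Rightarrow> 'v list \<Rightarrow> 'v \<Rightarrow> 'v" where
  "product_T \<rho> T us u = \<rho> (map T us) u"

definition bracket_T ::
  "nat \<Rightarrow> ('k::field \<Rightarrow> 'v::ab_group_add \<Rightarrow> 'v) \<Rightarrow> ('g list \<Rightarrow> 'v \<Rightarrow> 'v) \<Rightarrow> ('v \<Rightarrow> 'g) \<Rightarrow>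
     'v list \<Rightarrow> 'v" where
  "bracket_T n sV \<rho> T us =
     (\<Sum>i<n. sV ((-1) ^ (n - Suc i)) (\<rho> (map T (omit i us)) (us ! i)))"

end

theory Submission
  imports Defs
begin

text \<open>
  The Rota-Baxter identity says \<open>T (bracket_T us) = br (map T us)\<close>, so the two representation
  identities, evaluated at arguments \<open>T u\<close>, are the two pre-Lie identities.  The fundamental
  identity for \<open>bracket_T\<close> then holds in every \<open>n\<close>-pre-Lie algebra.
\<close>

section \<open>Lists with one entry omitted\<close>

lemma length_omit: "i < length xs \<Longrightarrow> length (omit i xs) = length xs - 1"
  by (simp add: omit_def)

text \<open>\<open>if k < i then k else Suc k\<close> enumerates the indices other than
  \<open>i\<close> in increasing order; it translates positions of \<open>omit i xs\<close> into
  positions of \<open>xs\<close>.\<close>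

lemma nth_omit:
  assumes "i < length xs" "k < length xs - 1"
  shows "omit i xs ! k = xs ! (if k < i then k else Suc k)"
  using assms by (auto simp: omit_def nth_append)

lemma map_omit: "map f (omit i xs) = omit i (map f xs)"
  by (simp add: omit_def take_map drop_map)

lemma omit_update_same: "omit i (xs[i := a]) = omit i xs"
  by (simp add: omit_def)

lemma omit_update:
  assumes "i < length xs" "k < length xs - 1"
  shows "omit i (xs[(if k < i then k else Suc k) := a]) = (omit i xs)[k := a]"
  using assms by (intro nth_equalityI) (auto simp: length_omit nth_omit nth_list_update)

lemma skip_preimage:
  fixes i j :: nat
  assumes "i < n" "j < n" "i \<noteq> j"
  shows "\<exists>k<n - 1. (if k < j then k else Suc k) = i"
  using assms by (intro exI[of _ "if i < j then i else i - 1"]) auto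

text \<open>The first pre-Lie identity, applied to a list shortened at \<open>j\<close>, produces
  sums over its \<open>n - 1\<close> positions; in terms of indices of the full list they can be
  compared with other double sums.\<close>

lemma sum_skip:
  assumes "j < n"
  shows "(\<Sum>k<n - 1. F (if k < j then k else Suc k)) = (\<Sum>k\<in>{..<n} - {j}. F k)"
proof (rule sum.reindex_bij_betw)
  show "bij_betw (\<lambda>k. if k < j then k else Suc k) {..<n - 1} ({..<n} - {j})"
    unfolding bij_betw_def
  proof (intro conjI set_eqI iffI)
    show "inj_on (\<lambda>k. if k < j then k else Suc k) {..<n - 1}"
      by (auto simp: inj_on_def split: if_splits)
    fix i assume "i \<in> {..<n} - {j}"
    then obtain k where "k < n - 1" "(if k < j then k else Suc k) = i"
      using assms skip_preimage[of i n j] by blast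
    then show "i \<in> (\<lambda>k. if k < j then k else Suc k) ` {..<n - 1}"
      by force
  qed (use assms in \<open>auto split: if_splits\<close>)
qed

section \<open>Linear and alternating multilinear maps\<close>

lemma linear_sum_scaled:
  assumes "Vector_Spaces.linear s1 s2 f"
  shows "f (\<Sum>i\<in>I. s1 (c i) (v i)) = (\<Sum>i\<in>I. s2 (c i) (f (v i)))"
proof -
  interpret Vector_Spaces.linear s1 s2 f by fact
  show ?thesis by (simp add: sum scale)
qed

lemma linear_scaled_sum_maps:
  assumes "vector_space s1" "vector_space s2"
    and "\<And>i. i \<in> I \<Longrightarrow> Vector_Spaces.linear s1 s2 (f i)"
  shows "Vector_Spaces.linear s1 s2 (\<lambda>x. \<Sum>i\<in>I. s2 (c i) (f i x))"
proof -
  interpret vs1: vector_space s1 by fact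
  interpret vs2: vector_space s2 by fact
  show ?thesis
    using assms unfolding Vector_Spaces.linear_iff
    by (auto simp: vs2.scale_right_distrib sum.distrib vs2.scale_sum_right mult.commute)
qed

lemma wedge_map_linear:
  "wedge_map m sA sB f \<Longrightarrow> length xs = m \<Longrightarrow> i < m \<Longrightarrow>
    Vector_Spaces.linear sA sB (\<lambda>x. f (xs[i := x]))"
  by (simp add: wedge_map_def)

lemma wedge_map_alternating:
  assumes "wedge_map m sA sB f" "length xs = m" "i < m" "j < m" "i \<noteq> j" "xs ! i = xs ! j"
  shows "f xs = 0"
proof (cases "i < j")
  case True
  then show ?thesis using assms unfolding wedge_map_def by blast
next
  case False
  then have "j < i" "xs ! j = xs ! i" using assms by auto
  then show ?thesis using assms unfolding wedge_map_def by blast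
qed

text \<open>Polarization: with \<open>a + b\<close> in both adjacent slots the value is zero, and so
  are the two diagonal terms of its expansion.\<close>

lemma wedge_map_swap:
  assumes f: "wedge_map m sA sB f" and m: "m = length xs + length ys + 2"
  shows "f (xs @ a # b # ys) = - f (xs @ b # a # ys)"
proof -
  let ?F = "\<lambda>x y. f (xs @ x # y # ys)"
  have eq0: "?F x x = 0" for x
    by (rule wedge_map_alternating[OF f, of _ "length xs" "Suc (length xs)"])
      (auto simp: m nth_append)
  have "Vector_Spaces.linear sA sB (\<lambda>x. f ((xs @ a # b # ys)[length xs := x]))" for a b
    by (rule wedge_map_linear[OF f]) (auto simp: m)
  then have l1: "Vector_Spaces.linear sA sB (\<lambda>x. ?F x b)" for b
    by (simp add: list_update_append)
  have "Vector_Spaces.linear sA sB (\<lambda>x. f ((xs @ a # b # ys)[Suc (length xs) := x]))" for a b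
    by (rule wedge_map_linear[OF f]) (auto simp: m)
  then have l2: "Vector_Spaces.linear sA sB (\<lambda>x. ?F a x)" for a
    by (simp add: list_update_append)
  have "?F (a + b) (a + b) = ?F a a + ?F a b + (?F b a + ?F b b)"
    using l1 l2 unfolding Vector_Spaces.linear_iff by simp
  then have "?F a b + ?F b a = 0" by (simp add: eq0)
  then show ?thesis by (rule eq_neg_iff_add_eq_0[THEN iffD2])
qed

text \<open>Carrying \<open>a\<close> to the left across \<open>ys\<close> takes
  \<open>length ys\<close> adjacent transpositions, each costing one sign.\<close>

lemma wedge_map_move:
  assumes f: "wedge_map m sA sB f" and m: "m = length xs + length ys + length zs + 1"
    and B: "vector_space sB"
  shows "f (xs @ ys @ a # zs) = sB ((-1) ^ length ys) (f (xs @ a # ys @ zs))"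
  using m
proof (induction ys arbitrary: xs)
  case Nil
  interpret vector_space sB by fact
  show ?case by simp
next
  case (Cons y ys)
  interpret vector_space sB by fact
  \<comment> \<open>With \<open>y\<close> counted as part of the prefix, the induction hypothesis
    brings \<open>a\<close> next to \<open>y\<close>; one swap remains.\<close>
  have "f (xs @ (y # ys) @ a # zs) = sB ((-1) ^ length ys) (f (xs @ y # a # ys @ zs))"
    using Cons.IH[of "xs @ [y]"] Cons.prems by simp
  also have "f (xs @ y # a # ys @ zs) = - f (xs @ a # y # ys @ zs)"
    by (rule wedge_map_swap[OF f]) (use Cons.prems in auto)
  finally show ?case by simp
qed

lemma wedge_map_compose:
  fixes T :: "'c::ab_group_add \<Rightarrow> 'a::ab_group_add"
  assumes f: "wedge_map m sA sB f" and T: "Vector_Spaces.linear sC sA T"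
  shows "wedge_map m sC sB (\<lambda>us. f (map T us))"
  unfolding wedge_map_def
proof (intro conjI allI impI)
  fix xs :: "'c list" and i assume *: "length xs = m \<and> i < m"
  then have "Vector_Spaces.linear sA sB (\<lambda>x. f ((map T xs)[i := x]))"
    using wedge_map_linear[OF f] by simp
  from Vector_Spaces.linear_compose[OF T this]
  show "Vector_Spaces.linear sC sB (\<lambda>x. f (map T (xs[i := x])))"
    by (simp add: o_def map_update)
next
  fix xs :: "'c list" and i j assume "length xs = m \<and> i < j \<and> j < m \<and> xs ! i = xs ! j"
  then show "f (map T xs) = 0"
    by (intro wedge_map_alternating[OF f, of _ i j]) auto
qed

text \<open>
  The identity for \<open>\<rho>\<close> on a bracket and the second pre-Lie identity place the bracket in the last
  and in the first slot, respectively; moving it costs the same sign on both sides.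
\<close>

lemma wedge_map_first_last_iff:
  assumes f: "wedge_map (Suc (length xs)) sA sB f" and B: "vector_space sB"
    and g: "\<And>i. i \<in> I \<Longrightarrow> Vector_Spaces.linear sB sB (g i)"
  shows "f (xs @ [a]) = (\<Sum>i\<in>I. sB (c i) (g i (f (xs @ [b i])))) \<longleftrightarrow>
    f (a # xs) = (\<Sum>i\<in>I. sB (c i) (g i (f (b i # xs))))"
proof -
  interpret vector_space sB by fact
  let ?e = "(-1) ^ length xs"
  have rot: "f (xs @ [d]) = sB ?e (f (d # xs))" for d
    using wedge_map_move[OF f _ B, of "[]" xs "[]" d] by simp
  have "g i (sB ?e w) = sB ?e (g i w)" if "i \<in> I" for i w
    using g[OF that] by (simp add: Vector_Spaces.linear_iff)
  then have "(\<Sum>i\<in>I. sB (c i) (g i (f (xs @ [b i])))) =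
      sB ?e (\<Sum>i\<in>I. sB (c i) (g i (f (b i # xs))))"
    unfolding rot by (simp add: scale_sum_right mult.commute)
  then show ?thesis by (simp add: rot)
qed

section \<open>The sub-adjacent n-Lie algebra of an n-pre-Lie algebra\<close>

context n_pre_Lie_algebra
begin

abbreviation bracket_C :: "'a list \<Rightarrow> 'a" where
  "bracket_C \<equiv> subadjacent_bracket n sA P"

lemma vector_space_sA: "vector_space sA"
  using fin_dim
  by (auto simp: fin_dim_vector_space_def finite_dimensional_vector_space_def)

lemma P_linear: "length xs = n - 1 \<Longrightarrow> Vector_Spaces.linear sA sA (P xs)"
  using product_wedge by (simp add: wedge_End_map_def)

lemma P_wedge: "wedge_map (n - 1) sA sA (\<lambda>xs. P xs v)"
  using product_wedge by (simp add: wedge_End_map_def)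

text \<open>\<open>P\<close> need not be alternating between its last argument and the others, so
  vanishing on equal entries \<open>i\<close> and \<open>j\<close> rests on a cancellation: a
  summand omitting any third index keeps both equal entries among its alternating arguments and is
  zero, and the summands \<open>i\<close> and \<open>j\<close> are opposite.\<close>

lemma wedge_bracket_C: "wedge_map n sA sA bracket_C"
  unfolding wedge_map_def
proof (intro conjI allI impI)
  fix xs :: "'a list" and k assume *: "length xs = n \<and> k < n"
  show "Vector_Spaces.linear sA sA (\<lambda>x. bracket_C (xs[k := x]))"
    unfolding subadjacent_bracket_def
  proof (intro linear_scaled_sum_maps vector_space_sA)
    fix i assume "i \<in> {..<n}"
    then have i: "i < n" by simp
    show "Vector_Spaces.linear sA sA (\<lambda>x. P (omit i (xs[k := x])) (xs[k := x] ! i))"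
    \<comment> \<open>Slot \<open>k\<close> feeds the last argument of \<open>P\<close> if
      \<open>i = k\<close>, and one of the alternating arguments otherwise.\<close>
    proof (cases "i = k")
      case True
      then show ?thesis using * by (simp add: omit_update_same P_linear length_omit)
    next
      case False
      then obtain l where l: "l < n - 1" "(if l < i then l else Suc l) = k"
        using * i skip_preimage[of k n i] by blast
      have "omit i (xs[k := x]) = (omit i xs)[l := x]" for x
        using omit_update[of i xs l x] l * i by simp
      then show ?thesis
        using wedge_map_linear[OF P_wedge, of "omit i xs" l] False * l i by (simp add: length_omit)
    qed
  qed
next
  fix xs :: "'a list" and i j
  assume *: "length xs = n \<and> i < j \<and> j < n \<and> xs ! i = xs ! j"
  interpret vector_space sA by (rule vector_space_sA)
  let ?t = "\<lambda>k. sA ((-1) ^ (n - Suc k)) (P (omit k xs) (xs ! k))"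
  have other: "?t k = 0" if k: "k < n" "k \<noteq> i" "k \<noteq> j" for k
  proof -
    obtain i' where i': "i' < n - 1" "(if i' < k then i' else Suc i') = i"
      using * k skip_preimage[of i n k] by auto
    obtain j' where j': "j' < n - 1" "(if j' < k then j' else Suc j') = j"
      using * k skip_preimage[of j n k] by blast
    have "P (omit k xs) v = 0" for v
      using wedge_map_alternating[OF P_wedge, of "omit k xs" i' j'] i' j' * k
      by (auto simp: length_omit nth_omit)
    then show ?thesis by simp
  qed
  have "bracket_C xs = (\<Sum>k\<in>{i, j}. ?t k)"
    unfolding subadjacent_bracket_def
    by (rule sum.mono_neutral_right) (use * other in auto)
  also have "\<dots> = ?t i + ?t j" using * by simp
  also have "\<dots> = 0"
  proof -
    \<comment> \<open>With \<open>xs\<close> cut as \<open>as @ a # bs @ a # cs\<close>, the lists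
      \<open>omit i xs\<close> and \<open>omit j xs\<close> differ only in the side of
      \<open>bs\<close> on which \<open>a\<close> stands.\<close>
    define as where "as = take i xs"
    define bs where "bs = take (j - Suc i) (drop (Suc i) xs)"
    define cs where "cs = drop (Suc j) xs"
    define a where "a = xs ! i"
    have as: "length as = i" and bs: "length bs = j - Suc i" and cs: "length cs = n - Suc j"
      using * by (auto simp: as_def bs_def cs_def)
    have "drop (Suc i) xs = bs @ drop (j - Suc i) (drop (Suc i) xs)"
      unfolding bs_def by (rule append_take_drop_id[symmetric])
    also have "drop (j - Suc i) (drop (Suc i) xs) = drop j xs"
      using * by simp
    also have "drop j xs = a # cs"
      using * by (simp add: Cons_nth_drop_Suc a_def cs_def)
    finally have d: "drop (Suc i) xs = bs @ a # cs" .
    have "xs = as @ a # drop (Suc i) xs"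
      unfolding as_def a_def using * by (intro id_take_nth_drop) simp
    then have xs: "xs = as @ a # bs @ a # cs" by (simp add: d)
    have oi: "omit i xs = as @ bs @ a # cs"
      by (simp add: omit_def d as_def)
    have oj: "omit j xs = as @ a # bs @ cs"
    proof -
      have "take j xs = as @ a # bs"
        using * as bs by (subst xs) (simp add: take_Cons' Suc_diff_Suc)
      then show ?thesis by (simp add: omit_def cs_def)
    qed
    have "P (omit i xs) a = sA ((-1) ^ length bs) (P (omit j xs) a)"
      unfolding oi oj by (rule wedge_map_move[OF P_wedge _ vector_space_sA]) (use * as bs cs in auto)
    then have "?t i = sA ((-1) ^ (n - Suc i + (j - Suc i))) (P (omit j xs) a)"
      by (simp add: bs a_def power_add)
    \<comment> \<open>The sign of summand \<open>i\<close> and the sign of the move across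
      \<open>bs\<close> combine to an exponent that differs from \<open>n - Suc j\<close> by an odd
      number.\<close>
    also have "n - Suc i + (j - Suc i) = Suc (n - Suc j) + 2 * (j - Suc i)"
      using * by linarith
    also have "(-1 :: 'k) ^ (Suc (n - Suc j) + 2 * (j - Suc i)) = - ((-1) ^ (n - Suc j))"
      by (simp only: power_add power_mult) simp
    finally have "?t i = - ?t j" using * by (simp add: a_def)
    then show ?thesis by simp
  qed
  finally show "bracket_C xs = 0" .
qed

text \<open>In the expansion of \<open>bracket_C (xs @ [bracket_C ys])\<close> the inner bracket is
  the last alternating argument, not the first, whenever it is not the one acted on.\<close>

lemma pre_Lie_2_last:
  assumes ys: "length ys = n" and xs: "length xs = n - 2"
  shows "P (xs @ [bracket_C ys]) z =
    (\<Sum>i<n. sA ((-1) ^ (n - Suc i)) (P (omit i ys) (P (xs @ [ys ! i]) z)))"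
proof -
  have "wedge_map (Suc (length xs)) sA sA (\<lambda>xs. P xs z)"
    using P_wedge xs n_ge_2 by (simp add: Suc_diff_Suc numeral_2_eq_2)
  from wedge_map_first_last_iff[OF this vector_space_sA, where I = "{..<n}"
      and g = "\<lambda>i. P (omit i ys)" and c = "\<lambda>i. (-1) ^ (n - Suc i)"
      and a = "bracket_C ys" and b = "(!) ys"]
  show ?thesis using pre_Lie_2[OF assms, of z] ys by (simp add: P_linear length_omit)
qed

text \<open>The summand omitting the last index has exponent 0; in all others \<open>z\<close> stays
  as the last alternating argument. The first part is suited to the first pre-Lie identity, the
  remainder to the second.\<close>

lemma bracket_C_snoc:
  assumes "length xs = n - 1"
  shows "bracket_C (xs @ [z]) =
    P xs z + (\<Sum>i<n - 1. sA ((-1) ^ (n - Suc i)) (P (omit i xs @ [z]) (xs ! i)))"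
proof -
  interpret vector_space sA by (rule vector_space_sA)
  obtain m where n: "n = Suc m" using n_ge_2 by (cases n) auto
  have "omit i (xs @ [z]) = omit i xs @ [z]" "(xs @ [z]) ! i = xs ! i" if "i < m" for i
    using that assms n by (auto simp: omit_def nth_append)
  moreover have "omit m (xs @ [z]) = xs" "(xs @ [z]) ! m = z"
    using assms n by (auto simp: omit_def nth_append)
  ultimately show ?thesis
    unfolding subadjacent_bracket_def n by (simp add: add.commute)
qed

lemma fundamental_identity_C:
  assumes xs: "length xs = n - 1" and ys: "length ys = n"
  shows "bracket_C (xs @ [bracket_C ys]) = (\<Sum>k<n. bracket_C (ys[k := bracket_C (xs @ [ys ! k])]))"
proof -
  \<comment> \<open>\<open>G j k\<close> collects the terms in which \<open>xs\<close> acts on an entry other than the one singled out by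
    the sum over \<open>j\<close>; these cancel by the first pre-Lie identity, and those with \<open>R\<close> by the second.\<close>
  interpret vector_space sA by (rule vector_space_sA)
  let ?s = "\<lambda>i. sA ((-1) ^ (n - Suc i))"
  define w where "w k = bracket_C (xs @ [ys ! k])" for k
  define G where "G j k = ?s j (P (omit j (ys[k := w k])) (ys ! j))" for j k
  define R where "R k = (\<Sum>i<n - 1. ?s i (P (omit i xs @ [ys ! k]) (xs ! i)))" for k
  have w: "w k = P xs (ys ! k) + R k" for k
    unfolding w_def R_def by (rule bracket_C_snoc[OF xs])
  \<comment> \<open>In each summand of \<open>bracket_C ys\<close> the first pre-Lie identity lets
    \<open>xs\<close> act either on the singled-out entry \<open>ys ! j\<close>, through
    \<open>P xs\<close>, or on one of the others, through the bracket.\<close>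
  have Pxs: "P xs (bracket_C ys) = (\<Sum>j<n. ?s j (P (omit j ys) (P xs (ys ! j))))
      + (\<Sum>j<n. \<Sum>k\<in>{..<n} - {j}. G j k)"
  proof -
    have "P xs (bracket_C ys) = (\<Sum>j<n. ?s j (P xs (P (omit j ys) (ys ! j))))"
      unfolding subadjacent_bracket_def by (rule linear_sum_scaled[OF P_linear[OF xs]])
    also have "\<dots> = (\<Sum>j<n. ?s j (P (omit j ys) (P xs (ys ! j))) + (\<Sum>k\<in>{..<n} - {j}. G j k))"
    proof (rule sum.cong[OF refl])
      fix j assume "j \<in> {..<n}"
      then have j: "j < n" by simp
      \<comment> \<open>Replacing position \<open>k\<close> of \<open>omit j ys\<close> amounts to
        replacing the corresponding entry of \<open>ys\<close> before omitting
        \<open>j\<close>.\<close>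
      have "(\<Sum>k<n - 1. ?s j (P ((omit j ys)[k := bracket_C (xs @ [omit j ys ! k])]) (ys ! j))) =
          (\<Sum>k<n - 1. G j (if k < j then k else Suc k))"
        by (rule sum.cong[OF refl], unfold G_def, subst omit_update)
          (use j ys in \<open>auto simp: nth_omit w_def\<close>)
      also have "\<dots> = (\<Sum>k\<in>{..<n} - {j}. G j k)"
        by (rule sum_skip[OF j])
      finally show "?s j (P xs (P (omit j ys) (ys ! j))) =
          ?s j (P (omit j ys) (P xs (ys ! j))) + (\<Sum>k\<in>{..<n} - {j}. G j k)"
        using pre_Lie_1[OF xs, of "omit j ys" "ys ! j"] j ys
        by (simp add: length_omit scale_right_distrib scale_sum_right add.commute)
    qed
    finally show ?thesis by (simp add: sum.distrib)
  qed
  have inner: "?s k (P (omit k ys) (R k)) =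
      (\<Sum>i<n - 1. ?s i (?s k (P (omit k ys) (P (omit i xs @ [ys ! k]) (xs ! i)))))"
    if "k < n" for k
    unfolding R_def
    by (subst linear_sum_scaled[OF P_linear])
      (use that ys in \<open>simp_all add: length_omit scale_sum_right mult.commute\<close>)
  \<comment> \<open>The second pre-Lie identity expands the inner bracket; exchanging the two sums
    then reassembles the remainders \<open>R k\<close>.\<close>
  have rest: "(\<Sum>i<n - 1. ?s i (P (omit i xs @ [bracket_C ys]) (xs ! i))) =
      (\<Sum>k<n. ?s k (P (omit k ys) (R k)))"
  proof -
    have "(\<Sum>i<n - 1. ?s i (P (omit i xs @ [bracket_C ys]) (xs ! i))) =
        (\<Sum>i<n - 1. \<Sum>k<n. ?s i (?s k (P (omit k ys) (P (omit i xs @ [ys ! k]) (xs ! i)))))"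
    proof (rule sum.cong[OF refl])
      fix i assume "i \<in> {..<n - 1}"
      then have "length (omit i xs) = n - 2" using xs by (simp add: length_omit)
      from pre_Lie_2_last[OF ys this]
      show "?s i (P (omit i xs @ [bracket_C ys]) (xs ! i)) =
          (\<Sum>k<n. ?s i (?s k (P (omit k ys) (P (omit i xs @ [ys ! k]) (xs ! i)))))"
        by (simp only: scale_sum_right)
    qed
    also have "\<dots> =
        (\<Sum>k<n. \<Sum>i<n - 1. ?s i (?s k (P (omit k ys) (P (omit i xs @ [ys ! k]) (xs ! i)))))"
      by (rule sum.swap)
    finally show ?thesis by (simp add: inner)
  qed
  \<comment> \<open>Only the summand of index \<open>k\<close> has the new entry as its last
    argument; there \<open>w k\<close> splits into its \<open>P xs\<close> part and
    \<open>R k\<close>. The other summands are \<open>G j k\<close>.\<close>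
  have term_k: "bracket_C (ys[k := w k]) =
      ?s k (P (omit k ys) (P xs (ys ! k))) + ?s k (P (omit k ys) (R k))
      + (\<Sum>j\<in>{..<n} - {k}. G j k)" if k: "k < n" for k
  proof -
    have "bracket_C (ys[k := w k]) = ?s k (P (omit k (ys[k := w k])) (ys[k := w k] ! k))
        + (\<Sum>j\<in>{..<n} - {k}. ?s j (P (omit j (ys[k := w k])) (ys[k := w k] ! j)))"
      unfolding subadjacent_bracket_def by (rule sum.remove) (use k in auto)
    also have "(\<Sum>j\<in>{..<n} - {k}. ?s j (P (omit j (ys[k := w k])) (ys[k := w k] ! j))) =
        (\<Sum>j\<in>{..<n} - {k}. G j k)"
      by (rule sum.cong) (auto simp: G_def)
    also have "?s k (P (omit k (ys[k := w k])) (ys[k := w k] ! k)) =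
        ?s k (P (omit k ys) (P xs (ys ! k) + R k))"
      using k ys by (simp add: omit_update_same w)
    also have "\<dots> = ?s k (P (omit k ys) (P xs (ys ! k))) + ?s k (P (omit k ys) (R k))"
      using P_linear[of "omit k ys"] k ys
      by (simp add: length_omit Vector_Spaces.linear_iff scale_right_distrib)
    finally show ?thesis .
  qed
  \<comment> \<open>Both sides sum \<open>G\<close> over all ordered pairs of distinct indices. This
    matches the last pair of terms; the \<open>P xs\<close> parts and the \<open>R\<close> parts
    already agree.\<close>
  have "(\<Sum>j<n. \<Sum>k\<in>{..<n} - {j}. G j k) = (\<Sum>k<n. \<Sum>j\<in>{..<n} - {k}. G j k)"
  proof -
    have split: "{k. k < n \<and> k \<noteq> j} = {..<n} - {j}" "{k. k < n \<and> j \<noteq> k} = {..<n} - {j}" for j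
      by auto
    show ?thesis
      using sum.swap_restrict[of "{..<n}" "{..<n}" G "\<lambda>j k. j \<noteq> k"] by (simp add: split)
  qed
  then have "bracket_C (xs @ [bracket_C ys]) = (\<Sum>k<n. bracket_C (ys[k := w k]))"
    by (simp add: bracket_C_snoc[OF xs] Pxs rest term_k sum.distrib ac_simps
        del: One_nat_def)
  then show ?thesis by (simp add: w_def)
qed

lemma subadjacent_n_Lie_algebra: "n_Lie_algebra n sA bracket_C"
  by unfold_locales (use n_ge_2 fin_dim wedge_bracket_C fundamental_identity_C in auto)

end

section \<open>The structures induced by a relative Rota-Baxter operator\<close>

lemma bracket_T_eq_subadjacent_bracket:
  "bracket_T n sV \<rho> T = subadjacent_bracket n sV (product_T \<rho> T)"
  by (simp add: fun_eq_iff bracket_T_def subadjacent_bracket_def product_T_def)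

context relative_Rota_Baxter_operator
begin

text \<open>Linearity carries \<open>T\<close> inside the signed sum, leaving the right side of
  \<open>Rota_Baxter\<close>. This is also the morphism property of \<open>T\<close>.\<close>

lemma T_bracket_T: "length us = n \<Longrightarrow> T (bracket_T n sV \<rho> T us) = br (map T us)"
  unfolding bracket_T_def by (simp add: linear_sum_scaled[OF linear_T] Rota_Baxter)

lemma wedge_product_T: "wedge_End_map (n - 1) sV sV (product_T \<rho> T)"
  using rho_wedge unfolding wedge_End_map_def product_T_def[abs_def]
  by (simp add: wedge_map_compose[OF _ linear_T, where f = "\<lambda>us. \<rho> us v" for v])

lemma n_pre_Lie_product_T: "n_pre_Lie_algebra n sV (product_T \<rho> T)"
proof
  show "2 \<le> n" "fin_dim_vector_space sV" "wedge_End_map (n - 1) sV sV (product_T \<rho> T)"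
    by (fact n_ge_2 fin_dim_V wedge_product_T)+
next
  fix xs ys :: "'v list" and z
  assume xs: "length xs = n - 1" and ys: "length ys = n - 1"
  \<comment> \<open>\<open>T\<close> turns each inner bracket into \<open>br\<close> of the images,
    so that \<open>rho_commutator\<close> at \<open>map T xs\<close> and \<open>map T ys\<close>
    gives the claim once its subtracted term is moved across.\<close>
  have "T (subadjacent_bracket n sV (product_T \<rho> T) (xs @ [y])) = br (map T xs @ [T y])" for y
    using T_bracket_T[of "xs @ [y]"] xs n_ge_2 by (simp add: bracket_T_eq_subadjacent_bracket)
  then show "product_T \<rho> T xs (product_T \<rho> T ys z) =
      (\<Sum>i<n - 1. product_T \<rho> T
        (ys[i := subadjacent_bracket n sV (product_T \<rho> T) (xs @ [ys ! i])]) z)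
      + product_T \<rho> T ys (product_T \<rho> T xs z)"
    using rho_commutator[of "map T xs" "map T ys" z] xs ys
    by (simp add: product_T_def map_update diff_eq_eq)
next
  fix ys xs :: "'v list" and z
  assume ys: "length ys = n" and xs: "length xs = n - 2"
  have vs: "vector_space sV"
    using fin_dim_V by (auto simp: fin_dim_vector_space_def finite_dimensional_vector_space_def)
  have wedge: "wedge_map (Suc (length (map T xs))) sg sV (\<lambda>xs. \<rho> xs z)"
    using rho_wedge xs n_ge_2 by (simp add: wedge_End_map_def Suc_diff_Suc numeral_2_eq_2)
  have lin: "Vector_Spaces.linear sV sV (\<rho> (omit i (map T ys)))" if "i \<in> {..<n}" for i
    using rho_wedge ys that by (simp add: wedge_End_map_def length_omit)
  \<comment> \<open>\<open>rho_bracket\<close> has the bracket in the last slot, the pre-Lie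
    identity in the first; the operators \<open>g i\<close> of the transfer are the outer
    \<open>\<rho>\<close> factors.\<close>
  have "\<rho> (br (map T ys) # map T xs) z =
      (\<Sum>i<n. sV ((-1) ^ (n - Suc i)) (\<rho> (omit i (map T ys)) (\<rho> (map T ys ! i # map T xs) z)))"
    using wedge_map_first_last_iff[OF wedge vs, where I = "{..<n}"
        and g = "\<lambda>i. \<rho> (omit i (map T ys))"
        and c = "\<lambda>i. (-1) ^ (n - Suc i)" and a = "br (map T ys)" and b = "(!) (map T ys)"]
      rho_bracket[of "map T xs" "map T ys" z] lin xs ys by simp
  then show "product_T \<rho> T (subadjacent_bracket n sV (product_T \<rho> T) ys # xs) z =
      (\<Sum>i<n. sV ((-1) ^ (n - Suc i))
        (product_T \<rho> T (omit i ys) (product_T \<rho> T (ys ! i # xs) z)))"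
    using T_bracket_T[OF ys] ys
    by (simp add: product_T_def map_omit flip: bracket_T_eq_subadjacent_bracket)
qed

end

theorem proposition3p18:
  fixes n :: nat
    and sg :: "'k::{alg_closed_field, field_char_0} \<Rightarrow> 'g::ab_group_add \<Rightarrow> 'g"
    and br :: "'g list \<Rightarrow> 'g"
    and sV :: "'k \<Rightarrow> 'v::ab_group_add \<Rightarrow> 'v"
    and \<rho> :: "'g list \<Rightarrow> 'v \<Rightarrow> 'v"
    and T :: "'v \<Rightarrow> 'g"
  assumes "relative_Rota_Baxter_operator n sg br sV \<rho> T"
  shows "n_pre_Lie_algebra n sV (product_T \<rho> T)
    \<and> is_subadjacent_n_Lie_algebra n sV (product_T \<rho> T) (bracket_T n sV \<rho> T)
    \<and> n_Lie_morphism n sV (bracket_T n sV \<rho> T) sg br T"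
proof -
  interpret relative_Rota_Baxter_operator n sg br sV \<rho> T by fact
  have pre: "n_pre_Lie_algebra n sV (product_T \<rho> T)"
    by (rule n_pre_Lie_product_T)
  have Lie: "n_Lie_algebra n sV (bracket_T n sV \<rho> T)"
    unfolding bracket_T_eq_subadjacent_bracket
    by (rule n_pre_Lie_algebra.subadjacent_n_Lie_algebra[OF pre])
  have "n_Lie_morphism n sV (bracket_T n sV \<rho> T) sg br T"
    using Lie n_Lie_algebra_axioms linear_T T_bracket_T by (simp add: n_Lie_morphism_def)
  with pre Lie show ?thesis
    by (simp add: is_subadjacent_n_Lie_algebra_def bracket_T_eq_subadjacent_bracket)
qed

end
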